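(* For any integer $\Delta\ge 3$, there exists an isolate-free graph $G$ with maximum degree $\Delta(G)=\Delta$ such that $$TC(G)\ge \begin{cases}\frac{\Delta^2}{4}+\Delta+\frac{3}{4} & \text{if } \Delta \text{ is odd},\\[2pt] \frac{\Delta^2}{4}+\Delta+1 & \text{if } \Delta\text{ is even.}\end{cases}$$
   Context: All graphs are finite and simple (no loops or multiple edges). A graph is isolate-free if it has no vertex of degree $0$. A set $T\subseteq V$ of vertices of a graph $G(V,E)$ is a total dominating set if every vertex of $V$ is adjacent to at least one vertex of $T$. Two disjoint sets $A,B\subset V$ form a total coalition if neither $A$ nor $B$ is a total dominating set, but $A\cup B$ is. A total coalition partition of $G$ is a partition $\Psi=\{C_1,\dots,C_k\}$ of $V$ into non-empty classes such that for every $i$ there exists $j\neq i$ such that $C_i$ and $C_j$ form a total coalition. The total coalition number $TC(G)$ of an isolate-free graph $G$ is the maximum cardinality (number of classes) of a total coalition partition of $G$. *)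

theory Defs
  imports Complex_Main "HOL-Library.Disjoint_Sets" "Graph_Theory.Digraph"
begin

text \<open>
  A finite simple graph is a \<^locale>\<open>graph\<close>: a finite, loop-free, symmetric digraph without
  parallel arcs. Every undirected edge is represented by its two opposite arcs, so the
  degree of a vertex is its \<^const>\<open>out_degree\<close> (and equally its \<^const>\<open>in_degree\<close>).
\<close>

definition isolate_free :: "('a, 'b) pre_digraph \<Rightarrow> bool" where
  "isolate_free G \<longleftrightarrow> (\<forall>v \<in> verts G. out_degree G v \<noteq> 0)"

definition max_degree :: "('a, 'b) pre_digraph \<Rightarrow> nat" where
  "max_degree G = Max (out_degree G ` verts G)"

definition total_dominating_set :: "('a, 'b) pre_digraph \<Rightarrow> 'a set \<Rightarrow> bool" where
  "total_dominating_set G T \<longleftrightarrow>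
     T \<subseteq> verts G \<and> (\<forall>v \<in> verts G. \<exists>t \<in> T. v \<rightarrow>\<^bsub>G\<^esub> t)"

definition total_coalition :: "('a, 'b) pre_digraph \<Rightarrow> 'a set \<Rightarrow> 'a set \<Rightarrow> bool" where
  "total_coalition G A B \<longleftrightarrow>
     A \<subseteq> verts G \<and> B \<subseteq> verts G \<and> A \<inter> B = {} \<and>
     \<not> total_dominating_set G A \<and> \<not> total_dominating_set G B \<and>
     total_dominating_set G (A \<union> B)"

definition total_coalition_partition :: "('a, 'b) pre_digraph \<Rightarrow> 'a set set \<Rightarrow> bool" where
  "total_coalition_partition G P \<longleftrightarrow>
     partition_on (verts G) P \<and> (\<forall>C \<in> P. \<exists>D \<in> P. D \<noteq> C \<and> total_coalition G C D)"

text \<open>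
  On \<^typ>\<open>nat\<close>, \<^const>\<open>Sup\<close> of a nonempty finite set is its maximum, and
  \<^term>\<open>Sup {} = (0 :: nat)\<close>; so a finite graph without any total coalition partition
  would get the value 0 rather than an unspecified one.
\<close>

definition total_coalition_number :: "('a, 'b) pre_digraph \<Rightarrow> nat" where
  "total_coalition_number G = Sup (card ` {P. total_coalition_partition G P})"

end

theory Submission
  imports Defs "HOL-Library.Countable"
begin

text \<open>
  Choose \<open>a + b = \<Delta> + 2\<close> with \<open>a\<close> and \<open>b\<close> as equal as possible; the bound to be reached is then
  \<open>a b\<close>. The classes \<open>C\<^sub>i\<^sub>j\<close> (\<open>i < a\<close>, \<open>j < b\<close>) are arranged so that \<open>C\<^sub>i\<^sub>0\<close> forms a total coalition
  with every other \<open>C\<^sub>i\<^sub>j\<close>. Every vertex has a neighbour in every \<open>C\<^sub>k\<^sub>0\<close>, except for one vertex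
  \<open>x\<^sub>i\<close> for each \<open>i\<close>, which has no neighbour in \<open>C\<^sub>i\<^sub>0\<close> but one in each of the other \<open>a - 1\<close> classes
  \<open>C\<^sub>k\<^sub>0\<close> and one in each of the \<open>b - 1\<close> classes \<open>C\<^sub>i\<^sub>j\<close> with \<open>j > 0\<close>; its degree is therefore
  exactly \<open>\<Delta>\<close>. Neighbours in the classes \<open>C\<^sub>k\<^sub>0\<close> are supplied cheaply by copies of the complete
  bipartite graph \<open>K\<^bsub>a,a\<^esub>\<close> each of whose sides contains one vertex of every \<open>C\<^sub>k\<^sub>0\<close>.
\<close>

section \<open>Graphs given by an adjacency relation\<close>

text \<open>The theorem asks for vertices in \<open>nat\<close>, so \<open>to_nat\<close> transports
  graphs from a more convenient vertex type.\<close>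

definition nat_graph :: "'v::countable set \<Rightarrow> ('v \<Rightarrow> 'v \<Rightarrow> bool) \<Rightarrow> (nat, nat \<times> nat) pre_digraph" where
  "nat_graph V E = \<lparr>verts = to_nat ` V,
     arcs = {(to_nat u, to_nat v) | u v. u \<in> V \<and> v \<in> V \<and> E u v}, tail = fst, head = snd\<rparr>"

lemma verts_nat_graph [simp]: "verts (nat_graph V E) = to_nat ` V"
  by (simp add: nat_graph_def)

lemma dominates_nat_graph [simp]:
  "to_nat u \<rightarrow>\<^bsub>nat_graph V E\<^esub> to_nat v \<longleftrightarrow> u \<in> V \<and> v \<in> V \<and> E u v"
  by (force simp: nat_graph_def arcs_ends_def arc_to_ends_def)

lemma graph_nat_graph:
  assumes "finite V" and sym: "\<And>u v. E u v \<Longrightarrow> E v u" and irrefl: "\<And>v. \<not> E v v"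
  shows "graph (nat_graph V E)"
proof
  have "arcs (nat_graph V E) \<subseteq> to_nat ` V \<times> to_nat ` V"
    by (auto simp: nat_graph_def)
  then show "finite (arcs (nat_graph V E))"
    using \<open>finite V\<close> by (meson finite_SigmaI finite_imageI finite_subset)
  show "symmetric (nat_graph V E)"
    using sym unfolding symmetric_conv by (fastforce simp: nat_graph_def)
qed (use assms in \<open>auto simp: nat_graph_def arc_to_ends_def\<close>)

lemma out_degree_nat_graph:
  assumes "u \<in> V"
  shows "out_degree (nat_graph V E) (to_nat u) = card {v \<in> V. E u v}"
proof -
  have "out_arcs (nat_graph V E) (to_nat u) = (\<lambda>v. (to_nat u, to_nat v)) ` {v \<in> V. E u v}"
    using assms by (auto simp: nat_graph_def out_arcs_def)
  moreover have "inj_on (\<lambda>v. (to_nat u, to_nat v)) {v \<in> V. E u v}"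
    by (auto simp: inj_on_def)
  ultimately show ?thesis
    by (simp add: out_degree_def card_image)
qed

lemma total_dominating_set_nat_graph:
  "total_dominating_set (nat_graph V E) (to_nat ` T) \<longleftrightarrow> T \<subseteq> V \<and> (\<forall>v\<in>V. \<exists>t\<in>T. E v t)"
  by (auto simp: total_dominating_set_def inj_image_subset_iff; blast)

lemma isolate_free_nat_graph:
  assumes "finite V" and "\<And>v. v \<in> V \<Longrightarrow> \<exists>t\<in>V. E v t"
  shows "isolate_free (nat_graph V E)"
  using assms by (auto simp: isolate_free_def out_degree_nat_graph card_gt_0_iff)

lemma max_degree_nat_graph_eqI:
  assumes "finite V" and "\<And>v. v \<in> V \<Longrightarrow> card {w \<in> V. E v w} \<le> d"
    and "u \<in> V" and "card {w \<in> V. E u w} = d"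
  shows "max_degree (nat_graph V E) = d"
  unfolding max_degree_def
proof (rule Max_eqI)
  show "d \<in> out_degree (nat_graph V E) ` verts (nat_graph V E)"
    using assms(3,4) by (force simp: out_degree_nat_graph)
qed (use assms in \<open>auto simp: out_degree_nat_graph\<close>)

text \<open>\<open>Sup\<close> on \<open>nat\<close> bounds only bounded sets; a finite vertex set
  leaves finitely many partitions.\<close>

lemma card_le_total_coalition_number:
  assumes "finite (verts G)" and "total_coalition_partition G P"
  shows "card P \<le> total_coalition_number G"
proof -
  have "{P. total_coalition_partition G P} \<subseteq> Pow (Pow (verts G))"
    by (auto simp: total_coalition_partition_def partition_on_def)
  then have "finite {P. total_coalition_partition G P}"
    using assms(1) by (simp add: finite_subset)
  then show ?thesis
    unfolding total_coalition_number_def using assms(2) by (intro le_cSup_finite) auto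
qed

section \<open>The extremal graph\<close>

datatype vertex = Outer nat nat | Inner nat nat bool nat

instance vertex :: countable
  by countable_datatype

text \<open>
  \<open>Outer i 0\<close> is the vertex \<open>x\<^sub>i\<close> above. The vertices \<open>Inner i j s k\<close> form a copy of \<open>K\<^bsub>a,a\<^esub>\<close>
  with sides \<open>s\<close> that belongs to \<open>Outer i j\<close>.
\<close>

definition vertices :: "nat \<Rightarrow> nat \<Rightarrow> vertex set" where
  "vertices a b = {Outer i j | i j. i < a \<and> j < b} \<union> {Inner i j s k | i j s k. i < a \<and> j < b \<and> k < a}"

text \<open>The exception \<open>k = i\<close> at \<open>j = 0\<close> cuts \<open>Outer i 0\<close>
  off from the class \<open>(i, 0)\<close>; the star around it supplies neighbours in the classes
  \<open>(i, j)\<close> with \<open>j > 0\<close>.\<close>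

fun adjacent :: "vertex \<Rightarrow> vertex \<Rightarrow> bool" where
  "adjacent (Outer i j) (Outer i' j') \<longleftrightarrow> i = i' \<and> (j = 0) \<noteq> (j' = 0)"
| "adjacent (Outer i j) (Inner i' j' s k) \<longleftrightarrow> i = i' \<and> j = j' \<and> s \<and> (j = 0 \<longrightarrow> k \<noteq> i)"
| "adjacent (Inner i j s k) (Outer i' j') \<longleftrightarrow> i = i' \<and> j = j' \<and> s \<and> (j = 0 \<longrightarrow> k \<noteq> i)"
| "adjacent (Inner i j s k) (Inner i' j' s' k') \<longleftrightarrow> i = i' \<and> j = j' \<and> s \<noteq> s'"

fun class_of :: "vertex \<Rightarrow> nat \<times> nat" where
  "class_of (Outer i j) = (i, j)"
| "class_of (Inner i j s k) = (k, 0)"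

definition class_set :: "nat \<Rightarrow> nat \<Rightarrow> nat \<times> nat \<Rightarrow> vertex set" where
  "class_set a b c = {v \<in> vertices a b. class_of v = c}"

lemma in_vertices [simp]:
  "Outer i j \<in> vertices a b \<longleftrightarrow> i < a \<and> j < b"
  "Inner i j s k \<in> vertices a b \<longleftrightarrow> i < a \<and> j < b \<and> k < a"
  by (auto simp: vertices_def)

lemma finite_vertices: "finite (vertices a b)"
proof -
  have "vertices a b \<subseteq> (\<lambda>(i, j). Outer i j) ` ({..<a} \<times> {..<b})
      \<union> (\<lambda>(i, j, s, k). Inner i j s k) ` ({..<a} \<times> {..<b} \<times> UNIV \<times> {..<a})"
    by (force simp: vertices_def)
  then show ?thesis
    by (rule finite_subset) auto
qed

lemma adjacent_sym: "adjacent u v \<Longrightarrow> adjacent v u"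
  by (cases u; cases v) auto

lemma adjacent_irrefl: "\<not> adjacent v v"
  by (cases v) auto

section \<open>Vertex degrees\<close>

lemma degree_Outer_0:
  assumes "i < a" "0 < b"
  shows "card {v \<in> vertices a b. adjacent (Outer i 0) v} = (a - 1) + (b - 1)"
proof -
  have "{v \<in> vertices a b. adjacent (Outer i 0) v}
      = Inner i 0 True ` ({..<a} - {i}) \<union> Outer i ` {1..<b}" (is "?N = ?I \<union> ?O")
  proof (rule set_eqI)
    fix v show "v \<in> ?N \<longleftrightarrow> v \<in> ?I \<union> ?O"
      using assms by (cases v) auto
  qed
  moreover have "card (?I \<union> ?O) = card ?I + card ?O"
    by (rule card_Un_disjoint) auto
  moreover have "card ?I = a - 1" "card ?O = b - 1"
    using assms by (simp_all add: card_image inj_on_def)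
  ultimately show ?thesis
    by simp
qed

text \<open>Apart from the vertices \<open>Outer i 0\<close>, a vertex sees at most one side of one
  bipartite copy and one further vertex, and \<open>a + 1\<close> is within the bound once
  \<open>b \<ge> 3\<close>.\<close>

lemma degree_le:
  assumes "v \<in> vertices a b" "3 \<le> b"
  shows "card {w \<in> vertices a b. adjacent v w} \<le> (a - 1) + (b - 1)"
proof (cases "\<exists>i. v = Outer i 0")
  case True
  then show ?thesis
    using assms degree_Outer_0 by auto
next
  case False
  obtain u i j s where "{w \<in> vertices a b. adjacent v w} \<subseteq> insert u (Inner i j s ` {..<a})"
  proof (cases v)
    case (Outer i j)
    with False have "{w \<in> vertices a b. adjacent v w} \<subseteq> insert (Outer i 0) (Inner i j True ` {..<a})"
      by (auto simp: vertices_def)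
    then show ?thesis by (rule that)
  next
    case (Inner i j s k)
    then have "{w \<in> vertices a b. adjacent v w} \<subseteq> insert (Outer i j) (Inner i j (\<not> s) ` {..<a})"
      by (auto simp: vertices_def)
    then show ?thesis by (rule that)
  qed
  then have "card {w \<in> vertices a b. adjacent v w} \<le> card (insert u (Inner i j s ` {..<a}))"
    by (rule card_mono[rotated]) simp
  also have "\<dots> \<le> Suc a"
    using card_insert_le_m1[of "Suc a" "Inner i j s ` {..<a}" u] card_image_le[of "{..<a}" "Inner i j s"]
    by simp
  also have "\<dots> \<le> (a - 1) + (b - 1)"
    using assms by (cases v) auto
  finally show ?thesis .
qed

section \<open>Domination and coalitions\<close>

lemma center_class_not_dominating:
  assumes "t \<in> class_set a b (i, 0)"
  shows "\<not> adjacent (Outer i 0) t"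
  using assms by (cases t) (auto simp: class_set_def)

lemma class_set_leaf:
  assumes "i < a" "j < b" "j \<noteq> 0"
  shows "class_set a b (i, j) = {Outer i j}"
proof (rule set_eqI)
  fix v show "v \<in> class_set a b (i, j) \<longleftrightarrow> v \<in> {Outer i j}"
    using assms by (cases v) (auto simp: class_set_def)
qed

lemma coalition_dominates:
  assumes "i < a" "j < b" "j \<noteq> 0" "v \<in> vertices a b"
  shows "\<exists>t \<in> class_set a b (i, 0) \<union> class_set a b (i, j). adjacent v t"
proof (cases "v = Outer i 0")
  case True
  then show ?thesis
    using assms by (simp add: class_set_leaf)
next
  case False
  show ?thesis
  proof (cases v)
    case (Outer i' j')
    then show ?thesis
      \<comment> \<open>The attached copy has a vertex labelled \<open>i\<close>; the missing edge
        would force \<open>v = Outer i 0\<close>.\<close>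
      using assms False by (intro bexI[of _ "Inner i' j' True i"]) (auto simp: class_set_def)
  next
    case (Inner i' j' s k)
    then show ?thesis
      using assms by (intro bexI[of _ "Inner i' j' (\<not> s) i"]) (auto simp: class_set_def)
  qed
qed

lemma total_coalition_class_sets:
  assumes "i < a" "j < b" "j \<noteq> 0"
  shows "total_coalition (nat_graph (vertices a b) adjacent)
    (to_nat ` class_set a b (i, 0)) (to_nat ` class_set a b (i, j))"
proof -
  have "\<not> total_dominating_set (nat_graph (vertices a b) adjacent) (to_nat ` class_set a b (i, 0))"
    unfolding total_dominating_set_nat_graph
    using center_class_not_dominating assms by (auto intro!: bexI[of _ "Outer i 0"])
  \<comment> \<open>A singleton cannot dominate its own vertex.\<close>
  moreover have "\<not> total_dominating_set (nat_graph (vertices a b) adjacent) (to_nat ` class_set a b (i, j))"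
    unfolding total_dominating_set_nat_graph
    using assms by (auto simp: class_set_leaf adjacent_irrefl intro!: bexI[of _ "Outer i j"])
  moreover have "total_dominating_set (nat_graph (vertices a b) adjacent)
      (to_nat ` (class_set a b (i, 0) \<union> class_set a b (i, j)))"
    unfolding total_dominating_set_nat_graph
    using coalition_dominates[OF assms] by (auto simp: class_set_def)
  moreover have "class_set a b c \<subseteq> vertices a b" for c
    by (auto simp: class_set_def)
  moreover have "to_nat ` class_set a b (i, 0) \<inter> to_nat ` class_set a b (i, j) = {}"
    using assms(3) by (auto simp: class_set_def)
  ultimately show ?thesis
    by (simp add: total_coalition_def image_Un image_mono)
qed

section \<open>The partition and its size\<close>

lemma total_coalition_commute: "total_coalition G A B \<longleftrightarrow> total_coalition G B A"
  by (auto simp: total_coalition_def Un_commute)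

lemma class_set_nonempty: "i < a \<Longrightarrow> j < b \<Longrightarrow> Outer i j \<in> class_set a b (i, j)"
  by (simp add: class_set_def)

text \<open>The index of a class can be read off any of its members, and the class has one; hence
  there are \<open>a * b\<close> classes.\<close>

lemma inj_on_class_set: "inj_on (\<lambda>c. to_nat ` class_set a b c) ({..<a} \<times> {..<b})"
proof (rule inj_onI)
  fix c d assume c: "c \<in> {..<a} \<times> {..<b}" and eq: "to_nat ` class_set a b c = to_nat ` class_set a b d"
  from eq have "class_set a b c = class_set a b d"
    by (simp add: inj_image_eq_iff)
  moreover have "Outer (fst c) (snd c) \<in> class_set a b c"
    using c class_set_nonempty by auto
  ultimately show "c = d"
    by (auto simp: class_set_def)
qed

lemma total_coalition_partition_class_sets:
  assumes "2 \<le> b"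
  shows "total_coalition_partition (nat_graph (vertices a b) adjacent)
    ((\<lambda>c. to_nat ` class_set a b c) ` ({..<a} \<times> {..<b}))"
    (is "total_coalition_partition ?G (?C ` ?I)")
  unfolding total_coalition_partition_def
proof
  have classes: "class_of v \<in> ?I" if "v \<in> vertices a b" for v
    using that assms by (cases v) auto
  show "partition_on (verts ?G) (?C ` ?I)"
  proof (rule partition_onI)
    show "\<Union> (?C ` ?I) = verts ?G"
      using classes by (auto simp: class_set_def)
    show "{} \<notin> ?C ` ?I"
      using class_set_nonempty by fastforce
    show "disjnt p q" if "p \<in> ?C ` ?I" "q \<in> ?C ` ?I" "p \<noteq> q" for p q
      using that by (auto simp: disjnt_def class_set_def)
  qed
  show "\<forall>C \<in> ?C ` ?I. \<exists>D \<in> ?C ` ?I. D \<noteq> C \<and> total_coalition ?G C D"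
  proof (intro ballI, elim imageE)
    fix C c assume "c \<in> ?I" and C: "C = ?C c"
    then obtain i j where c: "c = (i, j)" and "i < a" "j < b"
      by auto
    \<comment> \<open>Classes with \<open>j > 0\<close> pair with \<open>(i, 0)\<close>, which in
      turn pairs with \<open>(i, 1)\<close>, available as \<open>b \<ge> 2\<close>.\<close>
    define d where "d = (i, if j = 0 then 1 else 0 :: nat)"
    have "d \<in> ?I" "d \<noteq> c"
      using \<open>i < a\<close> assms by (auto simp: d_def c)
    moreover have "total_coalition ?G (?C c) (?C d)"
      using \<open>i < a\<close> \<open>j < b\<close> assms total_coalition_class_sets[of i a _ b]
      by (cases "j = 0") (auto simp: c d_def total_coalition_commute[of _ "?C (i, 0)"])
    moreover have "?C d \<noteq> ?C c"
      using inj_on_eq_iff[OF inj_on_class_set \<open>d \<in> ?I\<close> \<open>c \<in> ?I\<close>] \<open>d \<noteq> c\<close> by simp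
    ultimately show "\<exists>D \<in> ?C ` ?I. D \<noteq> C \<and> total_coalition ?G C D"
      unfolding C by (intro bexI[of _ "?C d"] conjI imageI)
  qed
qed

theorem theorem3p3:
  fixes \<Delta> :: nat
  assumes "\<Delta> \<ge> 3"
  shows "\<exists>G :: (nat, nat \<times> nat) pre_digraph.
    graph G \<and> isolate_free G \<and> max_degree G = \<Delta> \<and>
    real (total_coalition_number G) \<ge>
      (if odd \<Delta> then (real \<Delta>)\<^sup>2 / 4 + real \<Delta> + 3 / 4
       else (real \<Delta>)\<^sup>2 / 4 + real \<Delta> + 1)"
proof -
  \<comment> \<open>Rounding up goes to \<open>b\<close>, so that \<open>b \<ge> 3\<close> holds
    already for \<Delta> = 3.\<close>
  define a b where "a = \<Delta> div 2 + 1" and "b = (\<Delta> + 1) div 2 + 1"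
  have a: "0 < a" and b: "3 \<le> b" and sum: "(a - 1) + (b - 1) = \<Delta>"
    using assms by (auto simp: a_def b_def)
  define G where "G = nat_graph (vertices a b) adjacent"
  have "graph G"
    unfolding G_def by (rule graph_nat_graph[OF finite_vertices adjacent_sym adjacent_irrefl])
  moreover have "isolate_free G"
    unfolding G_def
  proof (rule isolate_free_nat_graph[OF finite_vertices])
    show "\<exists>t \<in> vertices a b. adjacent v t" if "v \<in> vertices a b" for v
      using coalition_dominates[OF a _ _ that, of 1] b by (auto simp: class_set_def)
  qed
  moreover have "max_degree G = \<Delta>"
    unfolding G_def using degree_le[of _ a b] degree_Outer_0[of 0 a b] a b sum finite_vertices
    by (intro max_degree_nat_graph_eqI[where u = "Outer 0 0"]) auto
  moreover have "a * b \<le> total_coalition_number G"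
    using card_le_total_coalition_number[OF _ total_coalition_partition_class_sets[of b a]]
      b finite_vertices[of a b] inj_on_class_set[of a b]
    by (simp add: G_def card_image)
  then have "real a * real b \<le> real (total_coalition_number G)"
    by (metis of_nat_le_iff of_nat_mult)
  \<comment> \<open>The product is \<open>(k + 1) * (k + 2)\<close> for \<Delta> =
    \<open>2 * k + 1\<close> and the square of \<open>k + 1\<close> for \<Delta> =
    \<open>2 * k\<close>.\<close>
  moreover have "real a * real b = (if odd \<Delta> then (real \<Delta>)\<^sup>2 / 4 + real \<Delta> + 3 / 4
      else (real \<Delta>)\<^sup>2 / 4 + real \<Delta> + 1)"
  proof (cases "odd \<Delta>")
    case True
    then obtain k where "\<Delta> = 2 * k + 1" by (elim oddE)
    then show ?thesis
      by (simp add: a_def b_def power2_eq_square field_simps)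
  next
    case False
    then obtain k where "\<Delta> = 2 * k" by (auto elim: evenE)
    then show ?thesis
      by (simp add: a_def b_def power2_eq_square field_simps)
  qed
  ultimately show ?thesis
    by (intro exI[of _ G]) simp
qed

end
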